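(* Let $f:X\to X$ be a continuous map of a compact metric space $X$ which is not uniquely ergodic. If $f$ satisfies the specification property, then the completely-irregular set $CI(f)$ is residual in $X$. If $f$ satisfies almost specification (i.e. the $g$-almost product property for some blowup function $g$), then $CI(f)$ is residual in $\Delta:=\bigcup_{\nu\in\mathcal{M}_f(X)}\mathrm{Support}(\nu)$, i.e. $CI(f)\cap\Delta$ is a residual subset of $\Delta$.
   Context: $(X,d)$ is a compact metric space, $f:X\to X$ continuous, $C^0(X)$ the space of continuous real functions on $X$, $\mathcal{M}_f(X)$ the set of $f$-invariant Borel probability measures. A set is residual in a Baire space if it contains a countable intersection of dense open sets. Irregular sets: $I(\phi,f)$ is the set of $x\in X$ for which $\lim_{n\to\infty}\frac1n\sum_{i=0}^{n-1}\phi(f^i(x))$ does not exist. $\hat{C}^0_f(X)=\{\phi\in C^0(X):I(\phi,f)\ne\emptyset\}$, and $CI(f)=\bigcap_{\phi\in\hat{C}^0_f(X)}I(\phi,f)$. Specification property: for every $\epsilon>0$ there is an integer $M(\epsilon)$ such that for any $k\ge2$, any $x_1,\dots,x_k\in X$ and any integers $0\le a_1\le b_1<a_2\le b_2<\cdots<a_k\le b_k$ with $a_{i+1}-b_i\ge M(\epsilon)$ $(1\le i\le k-1)$ there is $x\in X$ with $d(f^j(x),f^j(x_i))<\epsilon$ for $a_i\le j\le b_i$, $1\le i\le k$. $g$-almost product property: let $\Lambda_n=\{0,1,\dots,n-1\}$. A blowup function is a nondecreasing unbounded map $g$ from the positive integers to the nonnegative integers with $g(n)<n$ and $g(n)/n\to0$.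 Put $B_n(g;x,\varepsilon)=\{y\in X:\exists\Lambda\subseteq\Lambda_n,\ |\Lambda_n\setminus\Lambda|\le g(n),\ d(f^jx,f^jy)\le\varepsilon\ \forall j\in\Lambda\}$. $f$ has the $g$-almost product property if there is a nonincreasing $m:\mathbb{R}^+\to\mathbb{N}$ such that for all $k\ge2$, $x_1,\dots,x_k\in X$, $\varepsilon_1,\dots,\varepsilon_k>0$ and integers $n_i\ge m(\varepsilon_i)$ $(1\le i\le k)$, $\bigcap_{j=1}^kf^{-M_{j-1}}B_{n_j}(g;x_j,\varepsilon_j)\ne\emptyset$, where $M_0=0$, $M_i=n_1+\cdots+n_i$. *)

theory Defs
  imports "HOL-Probability.Probability"
begin

text \<open>
  The dynamical system is a map \<open>f :: 'a \<Rightarrow> 'a\<close> on a metric-space type, so that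
  the phase space \<open>X\<close> is \<open>UNIV\<close>. The compactness of \<open>UNIV\<close> and the continuity of \<open>f\<close>
  are hypotheses of the theorem.
\<close>

definition invariant_measures :: "('a::metric_space \<Rightarrow> 'a) \<Rightarrow> 'a measure set" where
  "invariant_measures f = {\<mu>. prob_space \<mu> \<and> sets \<mu> = sets borel \<and> distr \<mu> borel f = \<mu>}"

definition uniquely_ergodic :: "('a::metric_space \<Rightarrow> 'a) \<Rightarrow> bool" where
  "uniquely_ergodic f \<longleftrightarrow> (\<exists>!\<mu>. \<mu> \<in> invariant_measures f)"

definition measure_support :: "'a::metric_space measure \<Rightarrow> 'a set" where
  "measure_support \<mu> = {x. \<forall>U. open U \<and> x \<in> U \<longrightarrow> emeasure \<mu> U > 0}"

definition supports_union :: "('a::metric_space \<Rightarrow> 'a) \<Rightarrow> 'a set" where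
  "supports_union f = (\<Union>\<nu>\<in>invariant_measures f. measure_support \<nu>)"

definition residual_in :: "'a topology \<Rightarrow> 'a set \<Rightarrow> bool" where
  "residual_in T S \<longleftrightarrow> S \<subseteq> topspace T \<and>
     (\<exists>\<U>. countable \<U> \<and> (\<forall>U\<in>\<U>. openin T U \<and> T closure_of U = topspace T) \<and>
        topspace T \<inter> \<Inter>\<U> \<subseteq> S)"

text \<open>The value of the Birkhoff average at \<open>n = 0\<close> is irrelevant for convergence.\<close>

definition irregular_set :: "('a \<Rightarrow> real) \<Rightarrow> ('a \<Rightarrow> 'a) \<Rightarrow> 'a set" where
  "irregular_set \<phi> f =
     {x. \<not> convergent (\<lambda>n. (1 / real n) * (\<Sum>i<n. \<phi> ((f ^^ i) x)))}"

definition irregular_observables :: "('a::metric_space \<Rightarrow> 'a) \<Rightarrow> ('a \<Rightarrow> real) set" where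
  "irregular_observables f = {\<phi>. continuous_on UNIV \<phi> \<and> irregular_set \<phi> f \<noteq> {}}"

definition completely_irregular_set :: "('a::metric_space \<Rightarrow> 'a) \<Rightarrow> 'a set" where
  "completely_irregular_set f = (\<Inter>\<phi>\<in>irregular_observables f. irregular_set \<phi> f)"

text \<open>
  Finite families \<open>x\<^sub>1, \<dots>, x\<^sub>k\<close> are functions on \<^typ>\<open>nat\<close> of which only the values on
  \<open>{1..k}\<close> are used. The point \<open>f\<^sup>j(x\<^sub>i)\<close> is shadowed at its own time \<open>j\<close>: the orbit
  segment is not shifted to start at \<open>a\<^sub>i\<close>.
\<close>

definition specification_property :: "('a::metric_space \<Rightarrow> 'a) \<Rightarrow> bool" where
  "specification_property f \<longleftrightarrow>
     (\<forall>\<epsilon>>0. \<exists>M::nat. \<forall>k\<ge>2. \<forall>(x :: nat \<Rightarrow> 'a) (a :: nat \<Rightarrow> nat) (b :: nat \<Rightarrow> nat).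
        (\<forall>i\<in>{1..k}. a i \<le> b i) \<and>
        (\<forall>i\<in>{1..<k}. b i < a (Suc i) \<and> b i + M \<le> a (Suc i)) \<longrightarrow>
        (\<exists>y. \<forall>i\<in>{1..k}. \<forall>j\<in>{a i..b i}. dist ((f ^^ j) y) ((f ^^ j) (x i)) < \<epsilon>))"

text \<open>A blowup function lives on the positive integers; its value at \<open>0\<close> is unconstrained.\<close>

definition blowup_function :: "(nat \<Rightarrow> nat) \<Rightarrow> bool" where
  "blowup_function g \<longleftrightarrow>
     mono_on {1..} g \<and> \<not> bdd_above (g ` {1..}) \<and> (\<forall>n\<ge>1. g n < n) \<and>
     (\<lambda>n. real (g n) / real n) \<longlonglongrightarrow> 0"

definition almost_ball ::
    "('a::metric_space \<Rightarrow> 'a) \<Rightarrow> nat \<Rightarrow> (nat \<Rightarrow> nat) \<Rightarrow> 'a \<Rightarrow> real \<Rightarrow> 'a set" where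
  "almost_ball f n g x \<epsilon> =
     {y. \<exists>\<Lambda>\<subseteq>{..<n}. card ({..<n} - \<Lambda>) \<le> g n \<and>
           (\<forall>j\<in>\<Lambda>. dist ((f ^^ j) x) ((f ^^ j) y) \<le> \<epsilon>)}"

text \<open>
  The threshold \<open>m\<close> takes positive values, so that every block length \<open>n\<^sub>i\<close> is positive, as
  the domain of \<open>g\<close> requires. The sum over \<open>{1..<j}\<close> is \<open>M\<^sub>j\<^sub>-\<^sub>1 = n\<^sub>1 + \<dots> + n\<^sub>j\<^sub>-\<^sub>1\<close>.
\<close>

definition almost_product_property :: "(nat \<Rightarrow> nat) \<Rightarrow> ('a::metric_space \<Rightarrow> 'a) \<Rightarrow> bool" where
  "almost_product_property g f \<longleftrightarrow>
     (\<exists>m :: real \<Rightarrow> nat. antimono_on {0<..} m \<and> (\<forall>\<epsilon>>0. m \<epsilon> > 0) \<and>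
        (\<forall>k\<ge>2. \<forall>(x :: nat \<Rightarrow> 'a) (\<epsilon> :: nat \<Rightarrow> real) (n :: nat \<Rightarrow> nat).
           (\<forall>i\<in>{1..k}. \<epsilon> i > 0 \<and> n i \<ge> m (\<epsilon> i)) \<longrightarrow>
           (\<Inter>j\<in>{1..k}. (f ^^ (\<Sum>i\<in>{1..<j}. n i)) -` almost_ball f (n j) g (x j) (\<epsilon> j)) \<noteq> {}))"

definition almost_specification :: "('a::metric_space \<Rightarrow> 'a) \<Rightarrow> bool" where
  "almost_specification f \<longleftrightarrow> (\<exists>g. blowup_function g \<and> almost_product_property g f)"

end

theory Submission
  imports Defs
begin

text \<open>
  It suffices that the points whose Birkhoff averages of every continuous \<open>\<phi>\<close> have limit
  superior at least that of any other point form a residual set: applied to \<open>\<phi>\<close> and \<open>-\<phi>\<close>, this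
  makes such a point irregular as soon as some point is. By separability of the space of continuous
  functions only countably many open sets \<open>{x. \<exists>n\<ge>N. A\<^sub>n \<phi>(x) > \<alpha>}\<close> are involved, and it remains to
  show that each is dense. Under specification, shadow a given point at time \<open>0\<close> and then, after a
  gap, a point with large averages. Under almost specification, shadow periodically a segment
  that often visits a neighbourhood of a given point of a support and a long segment with large
  averages; an invariant measure obtained from such orbits charges the set of good points, which
  therefore meets its support.
\<close>

section \<open>Borel regularization of finitely additive probabilities\<close>

text \<open>Limits of empirical frequencies are set functions of this kind: every subset has a
  value, but countable additivity may fail. The construction below restores it on Borel
  sets.\<close>

locale finitely_additive_prob =
  fixes m :: "'a::metric_space set \<Rightarrow> real"
  assumes compact_space: "compact (UNIV :: 'a set)"
    and nonneg: "0 \<le> m A"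
    and total: "m UNIV = 1"
    and additive: "A \<inter> B = {} \<Longrightarrow> m (A \<union> B) = m A + m B"
begin

lemma m_mono: "A \<subseteq> B \<Longrightarrow> m A \<le> m B"
  using additive[of A "B - A"] nonneg[of "B - A"] by (simp add: Un_absorb1)

lemma m_empty: "m {} = 0"
  using additive[of "{}" "{}"] by simp

lemma m_subadditive: "m (A \<union> B) \<le> m A + m B"
  using additive[of A "B - A"] m_mono[of "B - A" B] by simp

lemma m_compl: "m (- A) = 1 - m A"
  using additive[of A "- A"] total by simp

text \<open>The value can be smaller than \<open>m U\<close>: mass that \<open>m\<close>
  concentrates at the boundary of \<open>U\<close> is lost. Closed sets are compact here, which will
  turn finite into countable subadditivity.\<close>

definition open_content :: "'a set \<Rightarrow> ennreal" where
  "open_content U = (SUP K\<in>{K. closed K \<and> K \<subseteq> U}. ennreal (m K))"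

definition outer_content :: "'a set \<Rightarrow> ennreal" where
  "outer_content A = (INF U\<in>{U. open U \<and> A \<subseteq> U}. open_content U)"

section \<open>From the content of open sets to an outer measure\<close>

lemma open_content_upper: "closed K \<Longrightarrow> K \<subseteq> U \<Longrightarrow> ennreal (m K) \<le> open_content U"
  unfolding open_content_def by (rule SUP_upper) simp

lemma open_content_mono: "U \<subseteq> V \<Longrightarrow> open_content U \<le> open_content V"
  unfolding open_content_def by (rule SUP_subset_mono) auto

lemma open_content_le: "open_content U \<le> ennreal (m U)"
  unfolding open_content_def by (rule SUP_least) (auto intro!: ennreal_leI m_mono)

lemma open_content_empty: "open_content {} = 0"
  using open_content_le[of "{}"] by (simp add: m_empty)

lemma outer_content_open: "open U \<Longrightarrow> outer_content U = open_content U"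
  unfolding outer_content_def by (intro antisym INF_lower INF_greatest open_content_mono) auto

lemma outer_content_lower: "open U \<Longrightarrow> A \<subseteq> U \<Longrightarrow> outer_content A \<le> open_content U"
  unfolding outer_content_def by (rule INF_lower) simp

lemma outer_content_mono: "A \<subseteq> B \<Longrightarrow> outer_content A \<le> outer_content B"
  unfolding outer_content_def by (rule INF_superset_mono) auto

text \<open>By normality, a closed set covered by two open sets is a union of two closed sets, one
  inside each. Induction reduces every finite cover to this case.\<close>

lemma closed_le_sum_open_content:
  assumes "closed K" "K \<subseteq> (\<Union>i<n. U i)" "\<And>i::nat. open (U i)"
  shows "ennreal (m K) \<le> (\<Sum>i<n. open_content (U i))"
  using assms(1,2)
proof (induction n arbitrary: K)
  case 0
  then show ?case by (simp add: m_empty)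
next
  case (Suc n)
  let ?A = "\<Union>i<n. U i"
  have "open ?A" by (intro open_UN ballI assms(3))
  have "closed (K - ?A)" "closed (K - U n)"
    using Suc.prems \<open>open ?A\<close> assms(3) by (auto intro: closed_Diff)
  moreover have "(K - ?A) \<inter> (K - U n) = {}"
    using Suc.prems(2) by (auto simp: lessThan_Suc)
  ultimately obtain P Q where PQ: "open P" "open Q" "K - ?A \<subseteq> P" "K - U n \<subseteq> Q" "P \<inter> Q = {}"
    using t4_space by meson
  \<comment> \<open>Since \<open>P\<close> and \<open>Q\<close> are disjoint, the two differences
    cover \<open>K\<close>; the first lies in \<open>?A\<close> and the second in
    \<open>U n\<close>.\<close>
  have "ennreal (m K) = ennreal (m ((K - P) \<union> (K - Q)))"
    using PQ(5) by (intro arg_cong[where f="\<lambda>A. ennreal (m A)"]) auto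
  also have "\<dots> \<le> ennreal (m (K - P) + m (K - Q))"
    by (intro ennreal_leI m_subadditive)
  also have "\<dots> = ennreal (m (K - P)) + ennreal (m (K - Q))"
    by (intro ennreal_plus nonneg)
  also have "\<dots> \<le> (\<Sum>i<n. open_content (U i)) + open_content (U n)"
    using PQ Suc.prems by (intro add_mono Suc.IH open_content_upper) (auto intro: closed_Diff)
  finally show ?case by simp
qed

text \<open>A closed subset of the union is compact, so finitely many of the \<open>U i\<close>
  already cover it.\<close>

lemma open_content_UN_le:
  fixes U :: "nat \<Rightarrow> 'a set"
  assumes U: "\<And>i. open (U i)"
  shows "open_content (\<Union>i. U i) \<le> (\<Sum>i. open_content (U i))"
  unfolding open_content_def[of "\<Union>i. U i"]
proof (rule SUP_least, clarify)
  fix K assume K: "closed K" "K \<subseteq> (\<Union>i. U i)"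
  have "compact K" using compact_Int_closed[OF compact_space K(1)] by simp
  then obtain I where I: "finite I" "K \<subseteq> (\<Union>i\<in>I. U i)"
    using compactE_image[of K UNIV U] K(2) U by metis
  obtain n where "I \<subseteq> {..<n}" using I(1) finite_nat_iff_bounded by blast
  with I(2) have "K \<subseteq> (\<Union>i<n. U i)" by blast
  from closed_le_sum_open_content[OF K(1) this U] have "ennreal (m K) \<le> (\<Sum>i<n. open_content (U i))" .
  also have "\<dots> \<le> (\<Sum>i. open_content (U i))" by (rule sum_le_suminf) auto
  finally show "ennreal (m K) \<le> (\<Sum>i. open_content (U i))" .
qed

lemma outer_measure_space_outer_content: "outer_measure_space UNIV outer_content"
  unfolding outer_measure_space_def
proof (intro conjI)
  show "positive UNIV outer_content"
    by (simp add: positive_def outer_content_open open_content_empty)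
  show "increasing UNIV outer_content"
    by (simp add: increasing_def outer_content_mono)
  show "countably_subadditive UNIV outer_content"
  proof (simp add: countably_subadditive_def, safe)
    fix A :: "nat \<Rightarrow> 'a set"
    show "outer_content (\<Union>i. A i) \<le> (\<Sum>n. outer_content (A n))"
    proof (rule ennreal_le_epsilon)
      fix e :: real assume e: "0 < e" and "(\<Sum>n. outer_content (A n)) < top"
      \<comment> \<open>The slacks add up to \<open>e\<close>. Finiteness of the sum makes every
        term finite, hence the inequality strict.\<close>
      then have "outer_content (A n) < outer_content (A n) + e * (1/2)^Suc n" for n
        by (auto simp add: less_top dest!: ennreal_suminf_lessD)
      then have "\<exists>U. open U \<and> A n \<subseteq> U \<and> open_content U < outer_content (A n) + e * (1/2)^Suc n" for n
        unfolding outer_content_def INF_less_iff by auto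
      then obtain U where U: "\<And>n. open (U n)" "\<And>n. A n \<subseteq> U n"
          "\<And>n. open_content (U n) < outer_content (A n) + e * (1/2)^Suc n"
        by metis
      have "outer_content (\<Union>i. A i) \<le> open_content (\<Union>i. U i)"
        using U by (intro outer_content_lower) auto
      also have "\<dots> \<le> (\<Sum>i. open_content (U i))" by (rule open_content_UN_le) (rule U)
      also have "\<dots> \<le> (\<Sum>n. outer_content (A n) + e * (1/2) ^ Suc n)"
        using U(3) by (intro suminf_le less_imp_le) auto
      also have "... = (\<Sum>n. outer_content (A n)) + (\<Sum>n. ennreal e * ennreal ((1/2) ^ Suc n))"
        using e by (subst suminf_add[symmetric])
          (auto simp del: ennreal_suminf_cmult simp add: ennreal_mult[symmetric])
      also have "\<dots> = (\<Sum>n. outer_content (A n)) + e"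
        unfolding ennreal_suminf_cmult
        by (subst suminf_ennreal_eq[OF zero_le_power power_half_series]) auto
      finally show "outer_content (\<Union>i. A i) \<le> (\<Sum>n. outer_content (A n)) + e" .
    qed
  qed
qed

text \<open>A closed \<open>K\<close> in \<open>V \<inter> U\<close> and a closed \<open>L\<close>
  in \<open>V - K\<close> are disjoint, so additivity of \<open>m\<close> bounds the sum of their
  values by the content of \<open>V\<close>. Suprema over \<open>L\<close> and then over
  \<open>K\<close> give Caratheodory's inequality for an open test set.\<close>

lemma open_content_split:
  assumes "open U" "open V"
  shows "open_content (V \<inter> U) + outer_content (V - U) \<le> open_content V"
proof -
  have "ennreal (m K) + outer_content (V - U) \<le> open_content V" if K: "closed K" "K \<subseteq> V \<inter> U" for K
  proof -
    have "outer_content (V - U) \<le> open_content (V - K)"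
      using K assms by (intro outer_content_lower) auto
    then have "ennreal (m K) + outer_content (V - U) \<le> ennreal (m K) + open_content (V - K)"
      by (rule add_left_mono)
    also have "\<dots> = (SUP L\<in>{L. closed L \<and> L \<subseteq> V - K}. ennreal (m K) + ennreal (m L))"
      unfolding open_content_def by (rule ennreal_SUP_add_right) auto
    also have "\<dots> \<le> open_content V"
    proof (rule SUP_least, clarify)
      fix L assume L: "closed L" "L \<subseteq> V - K"
      have "ennreal (m K) + ennreal (m L) = ennreal (m (K \<union> L))"
        using L by (subst additive) (auto simp: ennreal_plus nonneg)
      also have "\<dots> \<le> open_content V" using K L by (intro open_content_upper) auto
      finally show "ennreal (m K) + ennreal (m L) \<le> open_content V" .
    qed
    finally show ?thesis .
  qed
  then have "(SUP K\<in>{K. closed K \<and> K \<subseteq> V \<inter> U}. ennreal (m K) + outer_content (V - U)) \<le> open_content V"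
    by (intro SUP_least) auto
  then show ?thesis
    unfolding open_content_def[of "V \<inter> U"] by (subst ennreal_SUP_add_left[symmetric]) auto
qed

text \<open>Caratheodory's inequality passes from open test sets to arbitrary ones, because the
  outer content is an infimum over open supersets.\<close>

lemma open_in_lambda_system:
  assumes "open U"
  shows "U \<in> lambda_system UNIV UNIV outer_content"
proof -
  interpret P: algebra "UNIV :: 'a set" "UNIV :: 'a set set"
    using algebra_Pow[of "UNIV :: 'a set"] by simp
  have "outer_content (A \<inter> U) + outer_content (A - U) = outer_content A" for A
  proof (rule antisym)
    show "outer_content (A \<inter> U) + outer_content (A - U) \<le> outer_content A"
      unfolding outer_content_def[of A]
    proof (rule INF_greatest, clarify)
      fix V assume V: "open V" "A \<subseteq> V"
      have "outer_content (A \<inter> U) + outer_content (A - U) \<le> open_content (V \<inter> U) + outer_content (V - U)"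
        using V assms by (intro add_mono outer_content_lower outer_content_mono) auto
      also have "\<dots> \<le> open_content V" by (rule open_content_split) fact+
      finally show "outer_content (A \<inter> U) + outer_content (A - U) \<le> open_content V" .
    qed
    have "subadditive UNIV outer_content"
      using outer_measure_space_outer_content unfolding outer_measure_space_def
      by (intro P.countably_subadditive_subadditive) auto
    then have "outer_content ((A \<inter> U) \<union> (A - U)) \<le> outer_content (A \<inter> U) + outer_content (A - U)"
      by (rule subadditiveD) auto
    then show "outer_content A \<le> outer_content (A \<inter> U) + outer_content (A - U)"
      by (simp add: Int_Diff_Un)
  qed
  then show ?thesis by (simp add: P.lambda_system_eq)
qed

section \<open>The regularized Borel measure and its invariance\<close>

definition regularization :: "'a measure" where
  "regularization = measure_of UNIV (sets borel) outer_content"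

lemma sets_regularization: "sets regularization = sets borel"
  unfolding regularization_def
  using sets.sets_measure_of_eq[of borel] by simp

lemma space_regularization: "space regularization = UNIV"
  using sets_eq_imp_space_eq[OF sets_regularization] by simp

text \<open>By Caratheodory's theorem the outer content is a measure on its measurable sets, a
  sigma-algebra that contains the open sets and hence the Borel sets.\<close>

lemma emeasure_regularization:
  assumes "A \<in> sets borel"
  shows "emeasure regularization A = outer_content A"
proof -
  interpret P: sigma_algebra "UNIV :: 'a set" "UNIV :: 'a set set"
    using sigma_algebra_Pow[of "UNIV :: 'a set"] by simp
  let ?L = "lambda_system UNIV UNIV outer_content"
  have ms: "measure_space UNIV ?L outer_content"
    by (rule P.caratheodory_lemma) (rule outer_measure_space_outer_content)
  then interpret L: sigma_algebra UNIV ?L by (simp add: measure_space_def)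
  have "sets borel \<subseteq> ?L"
    unfolding borel_def
    by (subst sets_measure_of) (auto intro!: L.sigma_sets_subset open_in_lambda_system)
  then have "positive (sets borel) outer_content" "countably_additive (sets borel) outer_content"
    using ms unfolding measure_space_def positive_def countably_additive_def by auto
  moreover have "sigma_algebra UNIV (sets (borel :: 'a measure))"
    using sets.sigma_algebra_axioms[of "borel :: 'a measure"] by simp
  ultimately show ?thesis
    unfolding regularization_def using assms
    by (intro emeasure_measure_of_sigma) auto
qed

lemma emeasure_regularization_open: "open U \<Longrightarrow> emeasure regularization U = open_content U"
  by (simp add: emeasure_regularization outer_content_open)

lemma prob_space_regularization: "prob_space regularization"
proof
  have "open_content UNIV = 1"
    using open_content_le[of UNIV] open_content_upper[of UNIV UNIV] total by (auto intro: antisym)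
  then show "emeasure regularization (space regularization) = 1"
    by (simp add: space_regularization emeasure_regularization_open)
qed

text \<open>The open complement has content at most its \<open>m\<close>-value, and both total
  masses are 1. As in the portmanteau theorem, closed sets lose no mass in the limit.\<close>

lemma regularization_closed_ge:
  assumes "closed K"
  shows "ennreal (m K) \<le> emeasure regularization K"
proof -
  interpret prob_space regularization by (rule prob_space_regularization)
  have "emeasure regularization (- K) \<le> ennreal (1 - m K)"
    using assms open_content_le[of "- K"] by (subst emeasure_regularization_open) (auto simp: m_compl)
  then have "prob (space regularization - K) \<le> 1 - m K"
    using m_mono[of K UNIV] total
    by (simp add: emeasure_eq_measure space_regularization Compl_eq_Diff_UNIV ennreal_le_iff)
  then show ?thesis
    using assms by (simp add: prob_compl sets_regularization emeasure_eq_measure ennreal_leI)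
qed

lemma regularization_invariant:
  assumes f: "continuous_on UNIV f" and inv: "\<And>A. m (f -` A) = m A"
  shows "distr regularization borel f = regularization"
proof -
  interpret prob_space regularization by (rule prob_space_regularization)
  have f_meas: "f \<in> measurable regularization borel"
    using borel_measurable_continuous_onI[OF f]
    by (simp cong: measurable_cong_sets add: sets_regularization)
  \<comment> \<open>The preimage of a closed subset of \<open>U\<close> is a closed subset of the
    preimage of \<open>U\<close>, with the same \<open>m\<close>-value.\<close>
  have le: "emeasure regularization U \<le> emeasure regularization (f -` U)" if "open U" for U
  proof -
    have "open_content U \<le> open_content (f -` U)"
      unfolding open_content_def[of U]
    proof (rule SUP_least, clarify)
      fix K assume K: "closed K" "K \<subseteq> U"
      have "closed (f -` K)" using closed_vimage[OF K(1) f] .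
      then have "ennreal (m (f -` K)) \<le> open_content (f -` U)"
        using K by (intro open_content_upper) auto
      then show "ennreal (m K) \<le> open_content (f -` U)" by (simp add: inv)
    qed
    then show ?thesis
      using that open_vimage[OF that f] by (simp add: emeasure_regularization_open)
  qed
  have ge: "emeasure regularization (f -` K) \<le> emeasure regularization K" if "closed K" for K
  proof -
    have "K \<in> events" "f -` K \<in> events"
      using that closed_vimage[OF that f] by (auto simp: sets_regularization)
    moreover have "prob (- K) \<le> prob (f -` (- K))"
      using le[of "- K"] that unfolding emeasure_eq_measure by auto
    moreover have "- K = space regularization - K"
        "f -` (- K) = space regularization - f -` K"
      by (auto simp: space_regularization)
    ultimately have "prob (f -` K) \<le> prob K" by (simp add: prob_compl)
    then show ?thesis by (simp add: emeasure_eq_measure ennreal_leI)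
  qed
  \<comment> \<open>Complements reversed the inequality for closed sets. An open set of a metric
    space is an increasing union of closed sets, which carries the reversed inequality over to open
    sets.\<close>
  have eq: "emeasure regularization (f -` U) = emeasure regularization U" if U: "open U" for U
  proof (rule antisym)
    show "emeasure regularization U \<le> emeasure regularization (f -` U)" by (rule le) fact
    have "fsigma_in euclidean U"
      using U by (intro open_imp_fsigma_in metrizable_space_euclidean) simp
    then obtain K where K: "incseq K" "\<And>n::nat. closed (K n)" "(\<Union>n. K n) = U"
      unfolding fsigma_in_ascending by (auto simp: incseq_Suc_iff)
    have "incseq (\<lambda>n. f -` K n)" using K(1) by (auto simp: incseq_def)
    then have "(SUP n. emeasure regularization (f -` K n)) = emeasure regularization (\<Union>n. f -` K n)"
      using K closed_vimage[OF K(2) f]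
      by (intro SUP_emeasure_incseq) (auto simp: sets_regularization)
    also have "(\<Union>n. f -` K n) = f -` U" using K by auto
    finally have "emeasure regularization (f -` U) = (SUP n. emeasure regularization (f -` K n))" ..
    also have "\<dots> \<le> emeasure regularization U"
      using K U by (intro SUP_least order_trans[OF ge] emeasure_mono) (auto simp: sets_regularization)
    finally show "emeasure regularization (f -` U) \<le> emeasure regularization U" .
  qed
  show ?thesis
  proof (rule measure_eqI_generator_eq[where E="{U. open U}" and \<Omega>=UNIV and A="\<lambda>_. UNIV"])
    show "Int_stable {U :: 'a set. open U}" by (auto simp: Int_stable_def)
    show "sets (distr regularization borel f) = sigma_sets UNIV {U. open U}"
      by (simp add: borel_def)
    then show "sets regularization = sigma_sets UNIV {U. open U}"
      by (simp add: sets_regularization)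
    show "emeasure (distr regularization borel f) U = emeasure regularization U"
      if "U \<in> {U. open U}" for U
      using that eq[of U] f_meas by (simp add: emeasure_distr space_regularization)
    show "emeasure (distr regularization borel f) UNIV \<noteq> \<infinity>" for i :: nat
      using f_meas by (simp add: emeasure_distr)
  qed auto
qed

end

section \<open>Invariant measures from orbit segments\<close>

text \<open>The cube of functions into \<open>{0..1}\<close> is compact by Tychonoff. For an
  uncountable index type it need not be sequentially compact, so the limit is taken along a filter
  finer than \<open>sequentially\<close> and not along a subsequence.\<close>

lemma pointwise_cluster_filter:
  fixes s :: "nat \<Rightarrow> 'b \<Rightarrow> real"
  assumes "\<And>k a. s k a \<in> {0..1}"
  obtains F m where "F \<noteq> bot" "F \<le> sequentially" "\<And>a. ((\<lambda>k. s k a) \<longlongrightarrow> m a) F"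
proof -
  have "compact (PiE UNIV (\<lambda>_::'b. {0..1::real}))"
    unfolding compactin_euclidean_iff[symmetric] euclidean_product_topology[symmetric]
    by (subst compactin_PiE) auto
  moreover have "eventually (\<lambda>h. h \<in> PiE UNIV (\<lambda>_. {0..1})) (filtermap s sequentially)"
    using assms by (simp add: eventually_filtermap PiE_UNIV_domain)
  moreover have "filtermap s sequentially \<noteq> bot"
    by (simp add: filtermap_bot_iff)
  ultimately obtain m where m: "inf (nhds m) (filtermap s sequentially) \<noteq> bot"
    unfolding compact_filter by blast
  \<comment> \<open>This filter describes large indices \<open>k\<close> with \<open>s k\<close>
    close to \<open>m\<close>; such indices never run out because \<open>m\<close> is a cluster
    point.\<close>
  let ?F = "inf (filtercomap s (nhds m)) sequentially"
  have "?F \<noteq> bot"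
  proof
    assume "?F = bot"
    then have "eventually (\<lambda>_. False) ?F" by simp
    then obtain P Q where PQ: "eventually P (filtercomap s (nhds m))" "eventually Q sequentially"
        "\<And>k. P k \<Longrightarrow> Q k \<Longrightarrow> False"
      unfolding eventually_inf by blast
    then obtain R where R: "eventually R (nhds m)" "\<And>k. R (s k) \<Longrightarrow> P k"
      unfolding eventually_filtercomap by blast
    have "eventually (\<lambda>k. \<not> R (s k)) sequentially"
      using PQ(2) by eventually_elim (use PQ(3) R(2) in blast)
    then have "eventually (\<lambda>h. \<not> R h) (filtermap s sequentially)"
      by (simp add: eventually_filtermap)
    with R(1) have "eventually (\<lambda>_. False) (inf (nhds m) (filtermap s sequentially))"
      unfolding eventually_inf by blast
    with m show False by (simp add: trivial_limit_def)
  qed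
  moreover have "?F \<le> sequentially" by simp
  moreover have "((\<lambda>k. s k a) \<longlongrightarrow> m a) ?F" for a
  proof -
    have "filterlim s (nhds m) (filtercomap s (nhds m))"
      by (rule filterlim_filtercomap)
    then have "filterlim s (nhds m) ?F"
      by (rule filterlim_mono) auto
    moreover have "eventually (\<lambda>h. h a \<in> S) (nhds m)" if "open S" "m a \<in> S" for S
    proof -
      have "open ((\<lambda>h :: 'b \<Rightarrow> real. h a) -` S)"
        by (intro open_vimage continuous_on_product_coordinates that)
      with that show ?thesis by (auto simp: eventually_nhds)
    qed
    ultimately show ?thesis
      by (intro topological_tendstoI) (auto simp: filterlim_iff)
  qed
  ultimately show ?thesis using that by blast
qed

text \<open>A Krylov--Bogolyubov theorem: the cluster points of the empirical measures along ever
  longer orbit segments are only finitely additive as functions on all sets, but their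
  regularizations are invariant Borel measures.\<close>

lemma invariant_measure_of_visits:
  fixes f :: "'a::metric_space \<Rightarrow> 'a" and x :: "nat \<Rightarrow> 'a" and T :: "nat \<Rightarrow> nat"
  assumes "compact (UNIV :: 'a set)" and f: "continuous_on UNIV f"
    and T: "filterlim T at_top sequentially" and "closed C"
    and visits: "\<And>k. c * real (T k) \<le> (\<Sum>i<T k. indicator C ((f ^^ i) (x k)))"
  obtains \<mu> where "\<mu> \<in> invariant_measures f" "ennreal c \<le> emeasure \<mu> C"
proof -
  \<comment> \<open>For \<open>T k = 0\<close> all frequencies are 0 by division by zero, so total
    mass 1 holds only eventually.\<close>
  define s :: "nat \<Rightarrow> 'a set \<Rightarrow> real"
    where "s k A = (\<Sum>i<T k. indicator A ((f ^^ i) (x k))) / real (T k)" for k A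
  have s_range: "s k A \<in> {0..1}" for k A
  proof -
    have "(\<Sum>i<T k. indicator A ((f ^^ i) (x k))) \<le> (\<Sum>i<T k. 1 :: real)"
      by (intro sum_mono) (auto simp: indicator_def)
    then show ?thesis
      unfolding s_def by (auto intro!: divide_nonneg_nonneg sum_nonneg simp: divide_le_eq)
  qed
  obtain F m where F: "F \<noteq> bot" "F \<le> sequentially" and m: "\<And>A. ((\<lambda>k. s k A) \<longlongrightarrow> m A) F"
    using pointwise_cluster_filter[of s, OF s_range] by blast
  have "eventually (\<lambda>k. T k \<ge> 1) sequentially"
    using T by (simp add: filterlim_at_top)
  then have pos: "eventually (\<lambda>k. T k \<ge> 1) F"
    using F(2) by (rule filter_leD[rotated])
  interpret finitely_additive_prob m
  proof
    show "0 \<le> m A" for A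
      using s_range by (intro tendsto_lowerbound[OF m _ F(1)] always_eventually) auto
    have "eventually (\<lambda>k. s k UNIV = 1) F"
      using pos by eventually_elim (simp add: s_def)
    then show "m UNIV = 1"
      by (intro tendsto_unique[OF F(1) m] tendsto_eventually)
    show "m (A \<union> B) = m A + m B" if "A \<inter> B = {}" for A B
    proof -
      have "s k (A \<union> B) = s k A + s k B" for k
        unfolding s_def add_divide_distrib[symmetric] sum.distrib[symmetric]
        using that by (intro arg_cong2[where f="(/)"] sum.cong) (auto simp: indicator_def)
      then have "((\<lambda>k. s k (A \<union> B)) \<longlongrightarrow> m A + m B) F"
        using tendsto_add[OF m[of A] m[of B]] by simp
      then show ?thesis by (rule tendsto_unique[OF F(1) m])
    qed
  qed fact
  have inv: "m (f -` A) = m A" for A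
  proof -
    have "filterlim T at_top F" using filterlim_mono[OF T order_refl F(2)] .
    then have lim0: "((\<lambda>k. 1 / real (T k)) \<longlongrightarrow> 0) F"
      by (intro tendsto_divide_0[OF tendsto_const] filterlim_at_top_imp_at_infinity
          filterlim_compose[OF filterlim_real_sequentially])
    have "\<bar>s k (f -` A) - s k A\<bar> \<le> 1 / real (T k)" for k
    proof -
      \<comment> \<open>Taking the preimage of \<open>A\<close> shifts the orbit segment by one
        step; the difference telescopes to two end terms.\<close>
      let ?u = "\<lambda>i. indicator A ((f ^^ i) (x k)) :: real"
      have "s k (f -` A) - s k A = (\<Sum>i<T k. ?u (Suc i) - ?u i) / real (T k)"
        unfolding s_def by (simp add: sum_subtractf diff_divide_distrib indicator_def)
      also have "\<dots> = (?u (T k) - ?u 0) / real (T k)"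
        by (subst sum_lessThan_telescope[of ?u]) (rule refl)
      finally show ?thesis
        by (simp add: indicator_def abs_divide divide_right_mono)
    qed
    then have "((\<lambda>k. s k (f -` A) - s k A) \<longlongrightarrow> 0) F"
      by (intro Lim_null_comparison[OF _ lim0] always_eventually) auto
    moreover have "((\<lambda>k. s k (f -` A) - s k A) \<longlongrightarrow> m (f -` A) - m A) F"
      by (intro tendsto_diff m)
    ultimately show ?thesis using tendsto_unique[OF F(1)] by fastforce
  qed
  have "eventually (\<lambda>k. c \<le> s k C) F"
    using pos by eventually_elim (use visits in \<open>simp add: s_def le_divide_eq\<close>)
  then have "c \<le> m C" by (rule tendsto_lowerbound[OF m _ F(1)])
  then have "ennreal c \<le> emeasure regularization C"
    using regularization_closed_ge[OF \<open>closed C\<close>] ennreal_leI order_trans by blast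
  moreover have "regularization \<in> invariant_measures f"
    using regularization_invariant[OF f inv] prob_space_regularization sets_regularization
    by (simp add: invariant_measures_def)
  ultimately show ?thesis using that by blast
qed

text \<open>Otherwise every point of \<open>C\<close> has an open null neighbourhood, finitely many
  of these cover the compact set \<open>C\<close>, and \<open>C\<close> is null.\<close>

lemma closed_meets_measure_support:
  fixes C :: "'a::metric_space set"
  assumes "compact (UNIV :: 'a set)" "closed C" "sets \<mu> = sets borel" "emeasure \<mu> C > 0"
  shows "C \<inter> measure_support \<mu> \<noteq> {}"
proof
  assume "C \<inter> measure_support \<mu> = {}"
  then have "\<forall>w\<in>C. \<exists>U. open U \<and> w \<in> U \<and> emeasure \<mu> U = 0"
    unfolding measure_support_def by (auto simp: zero_less_iff_neq_zero)
  then obtain U where U: "\<And>w. w \<in> C \<Longrightarrow> open (U w) \<and> w \<in> U w \<and> emeasure \<mu> (U w) = 0"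
    by metis
  have "compact C" using compact_Int_closed[OF assms(1,2)] by simp
  then obtain D where D: "D \<subseteq> C" "finite D" "C \<subseteq> (\<Union>w\<in>D. U w)"
    using compactE_image[of C C U] U by (metis UN_iff subsetI)
  have "(\<Union>w\<in>D. U w) \<in> null_sets \<mu>"
    using D U assms(3) by (intro null_sets_UN' countable_finite null_setsI) auto
  then have "emeasure \<mu> C = 0"
    using D assms(2,3) by (metis null_sets_subset null_setsD1 borel_closed)
  with assms(4) show False by simp
qed

section \<open>Birkhoff averages and irregular points\<close>

abbreviation birkhoff_average :: "('a \<Rightarrow> 'a) \<Rightarrow> ('a \<Rightarrow> real) \<Rightarrow> nat \<Rightarrow> 'a \<Rightarrow> real" where
  "birkhoff_average f \<phi> n x \<equiv> (1 / real n) * (\<Sum>i<n. \<phi> ((f ^^ i) x))"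

lemma continuous_on_funpow:
  fixes f :: "'a::topological_space \<Rightarrow> 'a"
  shows "continuous_on UNIV f \<Longrightarrow> continuous_on UNIV (f ^^ n)"
proof (induction n)
  case (Suc n)
  then show ?case using continuous_on_compose2[of UNIV f UNIV "f ^^ n"] by (simp add: comp_def)
qed (simp add: id_def)

lemma continuous_on_birkhoff_average:
  assumes "continuous_on UNIV f" "continuous_on UNIV \<phi>"
  shows "continuous_on UNIV (birkhoff_average f \<phi> n)"
  by (intro continuous_intros continuous_on_compose2[OF assms(2)] continuous_on_funpow assms) auto

lemma birkhoff_average_uminus: "birkhoff_average f (\<lambda>x. - \<phi> x) n x = - birkhoff_average f \<phi> n x"
  by (simp add: sum_negf)

lemma birkhoff_average_perturb:
  assumes "\<And>x. \<bar>\<phi> x - \<psi> x\<bar> \<le> e"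
  shows "\<bar>birkhoff_average f \<phi> n x - birkhoff_average f \<psi> n x\<bar> \<le> e"
proof -
  have "e \<ge> 0" using order_trans[OF abs_ge_zero assms] .
  have "\<bar>\<Sum>i<n. \<phi> ((f ^^ i) x) - \<psi> ((f ^^ i) x)\<bar> \<le> (\<Sum>i<n. e)"
    by (intro order_trans[OF sum_abs] sum_mono assms)
  then have "\<bar>\<Sum>i<n. \<phi> ((f ^^ i) x) - \<psi> ((f ^^ i) x)\<bar> / real n \<le> e"
    using \<open>e \<ge> 0\<close> by (cases "n = 0") (auto simp: divide_le_eq mult.commute)
  then show ?thesis
    by (simp add: sum_subtractf abs_divide diff_divide_distrib[symmetric])
qed

section \<open>Separability of the space of continuous functions\<close>

text \<open>The members of the dense family are the finite minima of cones
  \<open>x \<mapsto> r + L \<cdot> dist x q\<close>.\<close>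

lemma countable_dense_continuous_functions:
  assumes compact: "compact (UNIV :: 'a::metric_space set)"
  obtains D :: "('a::metric_space \<Rightarrow> real) set" where "countable D"
    "\<And>\<psi>. \<psi> \<in> D \<Longrightarrow> continuous_on UNIV \<psi>"
    "\<And>\<phi> e. continuous_on UNIV \<phi> \<Longrightarrow> e > 0 \<Longrightarrow> \<exists>\<psi>\<in>D. \<forall>x. \<bar>\<phi> x - \<psi> x\<bar> \<le> e"
proof -
  have "\<exists>N. finite N \<and> (UNIV :: 'a set) \<subseteq> (\<Union>q\<in>N. ball q (1 / real (Suc k)))" for k
    using compact unfolding compact_eq_totally_bounded by auto
  then obtain N :: "nat \<Rightarrow> 'a set" where N: "\<And>k. finite (N k)"
      and cover: "\<And>k. UNIV \<subseteq> (\<Union>q\<in>N k. ball q (1 / real (Suc k)))"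
    by metis
  have net: "\<exists>q\<in>N k. dist q x < 1 / real (Suc k)" for k x
    using subsetD[OF cover[of k] UNIV_I[of x]] by simp
  \<comment> \<open>\<open>L\<close> is the common slope and \<open>A\<close> the set of apexes,
    given by position and height. Positions from the finite nets and rational heights leave
    countably many choices.\<close>
  define cones :: "nat \<times> ('a \<times> real) set \<Rightarrow> 'a \<Rightarrow> real"
    where "cones = (\<lambda>(L, A) x. Min ((\<lambda>(q, r). r + real L * dist x q) ` A))"
  define \<A> :: "('a \<times> real) set set" where "\<A> = {A. A \<subseteq> (\<Union>k. N k) \<times> \<rat> \<and> finite A}"
  define D where "D = cones ` (UNIV \<times> (\<A> - {{}}))"
  have "countable ((\<Union>k. N k) \<times> (\<rat> :: real set))"
    by (intro countable_SIGMA countable_UN countable_rat countable_finite[OF N]) auto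
  then have "countable \<A>"
    unfolding \<A>_def using countable_Collect_finite_subset by (simp add: conj_commute)
  then have "countable D"
    unfolding D_def by (intro countable_image countable_SIGMA) auto
  moreover have "continuous_on UNIV \<psi>" if "\<psi> \<in> D" for \<psi>
  proof -
    from that obtain L A where \<psi>: "\<psi> = cones (L, A)" and "finite A" "A \<noteq> {}"
      unfolding D_def \<A>_def by blast
    have "continuous_on UNIV (\<lambda>x. Min ((\<lambda>(q, r). r + real L * dist x q) ` A))"
      using \<open>finite A\<close> \<open>A \<noteq> {}\<close>
    proof (induction A rule: finite_ne_induct)
      case (singleton p)
      then show ?case by (auto simp: case_prod_beta intro!: continuous_intros)
    next
      case (insert p A)
      then have eq: "(\<lambda>x. Min ((\<lambda>(q, r). r + real L * dist x q) ` insert p A))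
          = (\<lambda>x. min (snd p + real L * dist x (fst p)) (Min ((\<lambda>(q, r). r + real L * dist x q) ` A)))"
        by (auto simp: case_prod_beta)
      show ?case unfolding eq by (intro continuous_intros continuous_on_min insert.IH)
    qed
    then show ?thesis by (simp add: \<psi> cones_def)
  qed
  moreover have "\<exists>\<psi>\<in>D. \<forall>x. \<bar>\<phi> x - \<psi> x\<bar> \<le> e" if \<phi>: "continuous_on UNIV \<phi>" and "e > 0" for \<phi> e
  proof -
    \<comment> \<open>Rounding the apex height, the rise of a cone across one mesh and the
      oscillation of \<open>\<phi>\<close> cost at most \<open>d\<close> each.\<close>
    define d where "d = e / 4"
    have "d > 0" using \<open>e > 0\<close> by (simp add: d_def)
    have "bounded (range \<phi>)"
      using compact_continuous_image[OF \<phi> compact] by (rule compact_imp_bounded)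
    then obtain B where B: "\<And>x. \<bar>\<phi> x\<bar> \<le> B" by (auto simp: bounded_iff)
    obtain \<delta> where "\<delta> > 0" and \<delta>: "\<And>x y. dist x y < \<delta> \<Longrightarrow> \<bar>\<phi> x - \<phi> y\<bar> < d"
      using compact_uniformly_continuous[OF \<phi> compact] \<open>d > 0\<close>
      unfolding uniformly_continuous_on_def dist_real_def by (metis UNIV_I dist_commute)
    \<comment> \<open>At distance \<open>\<delta>\<close> from its apex a cone has risen by
      \<open>2 * B\<close>, a bound for the oscillation of \<open>\<phi>\<close>, so distant cones
      cannot pull the minimum far below \<open>\<phi>\<close>.\<close>
    obtain L :: nat where L: "2 * B / \<delta> \<le> real L" using real_arch_simple by blast
    then have L: "2 * B \<le> real L * \<delta>" using \<open>\<delta> > 0\<close> by (simp add: divide_le_eq)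
    \<comment> \<open>The second bound keeps the rise across one mesh below \<open>d\<close>; adding
      1 avoids division by zero when \<open>L = 0\<close>.\<close>
    have "min \<delta> (d / (real L + 1)) > 0" using \<open>d > 0\<close> \<open>\<delta> > 0\<close> by simp
    then obtain k where "1 / real (Suc k) < min \<delta> (d / (real L + 1))"
      using nat_approx_posE by blast
    then have k: "1 / real (Suc k) < \<delta>" "1 / real (Suc k) < d / (real L + 1)" by auto
    have "\<exists>r\<in>\<rat>. \<bar>r - \<phi> q\<bar> < d" for q
      using Rats_dense_in_real[of "\<phi> q - d" "\<phi> q + d"] \<open>d > 0\<close> by (force simp: abs_less_iff)
    then obtain r where r: "\<And>q. r q \<in> \<rat>" "\<And>q. \<bar>r q - \<phi> q\<bar> < d" by metis
    define \<psi> where "\<psi> = cones (L, (\<lambda>q. (q, r q)) ` N k)"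
    have \<psi>_eq: "\<psi> x = Min ((\<lambda>q. r q + real L * dist x q) ` N k)" for x
      by (simp add: \<psi>_def cones_def image_image)
    have "N k \<noteq> {}" using net by blast
    then have "(L, (\<lambda>q. (q, r q)) ` N k) \<in> UNIV \<times> (\<A> - {{}})"
      using N r(1) by (auto simp: \<A>_def)
    then have "\<psi> \<in> D" unfolding \<psi>_def D_def by (rule imageI)
    moreover have "\<bar>\<phi> x - \<psi> x\<bar> \<le> e" for x
    proof -
      obtain q where q: "q \<in> N k" "dist q x < 1 / real (Suc k)" using net by blast
      have "\<psi> x \<le> r q + real L * dist x q"
        unfolding \<psi>_eq using N q(1) by (intro Min_le) auto
      moreover have "real L * dist x q \<le> d"
      proof -
        have "real L * dist x q \<le> (real L + 1) * (1 / real (Suc k))"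
          using q(2) by (intro mult_mono) (auto simp: dist_commute)
        also have "\<dots> \<le> d" using k(2) by (simp add: field_simps)
        finally show ?thesis .
      qed
      moreover have "\<bar>\<phi> q - \<phi> x\<bar> < d" using q(2) k(1) by (intro \<delta>) simp
      ultimately have "\<psi> x \<le> \<phi> x + e"
        using r(2)[of q] unfolding d_def by linarith
      moreover have "\<phi> x - e \<le> \<psi> x"
        unfolding \<psi>_eq
      proof (rule Min.boundedI)
        fix a assume "a \<in> (\<lambda>q. r q + real L * dist x q) ` N k"
        then obtain p where a: "a = r p + real L * dist x p" by auto
        show "\<phi> x - e \<le> a"
        proof (cases "dist x p < \<delta>")
          case True
          then have "\<bar>\<phi> x - \<phi> p\<bar> < d" by (rule \<delta>)
          moreover have "real L * dist x p \<ge> 0" by simp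
          ultimately show ?thesis
            using r(2)[of p] \<open>d > 0\<close> unfolding a d_def by linarith
        next
          case False
          then have "2 * B \<le> real L * dist x p"
            using mult_left_mono[of \<delta> "dist x p" "real L"] L by simp
          then show ?thesis
            using r(2)[of p] B[of p] B[of x] \<open>d > 0\<close> unfolding a d_def by linarith
        qed
      qed (use N \<open>N k \<noteq> {}\<close> in auto)
      ultimately show ?thesis by linarith
    qed
    ultimately show ?thesis by blast
  qed
  ultimately show ?thesis using that by blast
qed

text \<open>If the averages of \<open>\<phi>\<close> converge to \<open>l\<close> at a point of all
  the sets \<open>G j\<close>, then the averages at any \<open>y\<close> are eventually at most
  \<open>l + e\<close>. The same for \<open>- \<phi>\<close> forces convergence to \<open>l\<close>
  at every \<open>y\<close>, which is impossible for an irregular observable.\<close>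

lemma residual_completely_irregular:
  fixes f :: "'a::metric_space \<Rightarrow> 'a"
  assumes compact: "compact (UNIV :: 'a set)" and f: "continuous_on UNIV f"
    and approx: "\<And>\<phi> y \<alpha> \<beta> N x0 \<delta>. \<lbrakk>continuous_on UNIV \<phi>;
        \<exists>\<^sub>F n in sequentially. birkhoff_average f \<phi> n y > \<beta>; \<alpha> < \<beta>; x0 \<in> S; \<delta> > 0\<rbrakk>
      \<Longrightarrow> \<exists>x\<in>S. dist x x0 < \<delta> \<and> (\<exists>n\<ge>N. birkhoff_average f \<phi> n x > \<alpha>)"
  shows "residual_in (top_of_set S) (completely_irregular_set f \<inter> S)"
proof -
  obtain D :: "('a \<Rightarrow> real) set" where D: "countable D"
    "\<And>\<psi>. \<psi> \<in> D \<Longrightarrow> continuous_on UNIV \<psi>"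
    "\<And>\<phi> e. continuous_on UNIV \<phi> \<Longrightarrow> e > 0 \<Longrightarrow> \<exists>\<psi>\<in>D. \<forall>x. \<bar>\<phi> x - \<psi> x\<bar> \<le> e"
    using countable_dense_continuous_functions[OF compact] by metis
  \<comment> \<open>Here \<open>y\<close> ranges over the whole space, not only over
    \<open>S\<close>; the gap between \<open>\<alpha>\<close> and \<open>\<beta>\<close> is the
    margin that \<open>approx\<close> requires.\<close>
  define attained where "attained \<psi> \<alpha> \<longleftrightarrow>
      (\<exists>y. \<exists>\<beta>>\<alpha>. \<exists>\<^sub>F n in sequentially. birkhoff_average f \<psi> n y > \<beta>)" for \<psi> \<alpha>
  define J where "J = {(\<psi>, \<alpha>, N :: nat). \<psi> \<in> D \<and> \<alpha> \<in> \<rat> \<and> attained \<psi> \<alpha>}"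
  define G where "G = (\<lambda>(\<psi>, \<alpha>, N :: nat). S \<inter> {x. \<exists>n\<ge>N. birkhoff_average f \<psi> n x > \<alpha>})"
  have "countable (D \<times> (\<rat> :: real set) \<times> (UNIV :: nat set))"
    using D(1) countable_rat by (intro countable_SIGMA) auto
  then have "countable J" by (rule countable_subset[rotated]) (auto simp: J_def)
  have "openin (top_of_set S) (G j)" if "j \<in> J" for j
  proof -
    obtain \<psi> \<alpha> N where j: "j = (\<psi>, \<alpha>, N)" by (metis prod_cases3)
    have "open (\<Union>n\<in>{N..}. {x. birkhoff_average f \<psi> n x > \<alpha>})"
      using that j by (intro open_UN ballI open_Collect_less continuous_on_const
          continuous_on_birkhoff_average f D(2)) (auto simp: J_def)
    also have "(\<Union>n\<in>{N..}. {x. birkhoff_average f \<psi> n x > \<alpha>})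
        = {x. \<exists>n\<ge>N. birkhoff_average f \<psi> n x > \<alpha>}" by auto
    finally show ?thesis unfolding j G_def by (auto intro: openin_open_Int)
  qed
  moreover have "top_of_set S closure_of G j = S" if "j \<in> J" for j
  proof -
    obtain \<psi> \<alpha> N where j: "j = (\<psi>, \<alpha>, N)" by (metis prod_cases3)
    with that obtain y \<beta> where \<psi>: "continuous_on UNIV \<psi>" "\<alpha> < \<beta>"
        "\<exists>\<^sub>F n in sequentially. birkhoff_average f \<psi> n y > \<beta>"
      using D(2) by (auto simp: J_def attained_def)
    have "\<exists>x. x \<in> G j \<and> x \<in> T" if T: "x0 \<in> T" "openin (top_of_set S) T" for x0 T
    proof -
      obtain \<delta> where "\<delta> > 0" "\<And>x. x \<in> S \<Longrightarrow> dist x x0 < \<delta> \<Longrightarrow> x \<in> T" and "x0 \<in> S"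
        using T unfolding openin_euclidean_subtopology_iff by blast
      with approx[OF \<psi>(1,3,2), of x0 \<delta> N] show ?thesis unfolding j G_def by auto
    qed
    then show ?thesis by (auto simp: closure_of_def)
  qed
  moreover have "S \<inter> \<Inter>(G ` J) \<subseteq> completely_irregular_set f \<inter> S"
  proof -
    have eventually_le: "\<forall>\<^sub>F n in sequentially. birkhoff_average f \<phi> n y \<le> l + e"
      if x: "x \<in> S \<inter> \<Inter>(G ` J)" and \<phi>: "continuous_on UNIV \<phi>"
        and l: "(\<lambda>n. birkhoff_average f \<phi> n x) \<longlonglongrightarrow> l" and "e > 0" for x y \<phi> l e
    proof (rule ccontr)
      assume "\<not> ?thesis"
      then have freq: "\<exists>\<^sub>F n in sequentially. birkhoff_average f \<phi> n y > l + e"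
        unfolding frequently_def by (simp add: not_less)
      obtain \<psi> where \<psi>: "\<psi> \<in> D" "\<And>x. \<bar>\<phi> x - \<psi> x\<bar> \<le> e / 8"
        using D(3)[OF \<phi>, of "e / 8"] \<open>e > 0\<close> by auto
      have near: "\<bar>birkhoff_average f \<phi> n z - birkhoff_average f \<psi> n z\<bar> \<le> e / 8" for n z
        using \<psi>(2) by (rule birkhoff_average_perturb)
      \<comment> \<open>At \<open>y\<close> the \<open>\<psi>\<close>-averages exceed
        \<open>l + e / 2\<close> and thus \<open>\<alpha>\<close> infinitely often. At
        \<open>x\<close> they end up below \<open>l + e / 8 + e / 8\<close>, hence below
        \<open>\<alpha>\<close>.\<close>
      obtain \<alpha> where \<alpha>: "\<alpha> \<in> \<rat>" "l + e / 4 < \<alpha>" "\<alpha> < l + e / 2"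
        using Rats_dense_in_real[of "l + e / 4" "l + e / 2"] \<open>e > 0\<close> by auto
      have "\<exists>\<^sub>F n in sequentially. birkhoff_average f \<psi> n y > l + e / 2"
      proof (rule frequently_elim1[OF freq])
        fix n assume "birkhoff_average f \<phi> n y > l + e"
        with near[of n y] \<open>e > 0\<close> show "birkhoff_average f \<psi> n y > l + e / 2" by linarith
      qed
      then have "attained \<psi> \<alpha>" unfolding attained_def using \<alpha>(3) by blast
      then have "(\<psi>, \<alpha>, N) \<in> J" for N
        using \<psi>(1) \<alpha>(1) by (simp add: J_def)
      with x have x: "\<exists>n\<ge>N. birkhoff_average f \<psi> n x > \<alpha>" for N
        unfolding G_def by fastforce
      have "\<forall>\<^sub>F n in sequentially. birkhoff_average f \<phi> n x < l + e / 8"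
        using l \<open>e > 0\<close> by (intro order_tendstoD) auto
      then obtain N where "\<And>n. n \<ge> N \<Longrightarrow> birkhoff_average f \<phi> n x < l + e / 8"
        unfolding eventually_sequentially by blast
      with x[of N] obtain n where "birkhoff_average f \<phi> n x < l + e / 8" "birkhoff_average f \<psi> n x > \<alpha>"
        by blast
      with near[of n x] \<alpha>(2) show False by linarith
    qed
    have "x \<in> irregular_set \<phi> f"
      if x: "x \<in> S \<inter> \<Inter>(G ` J)" and \<phi>: "\<phi> \<in> irregular_observables f" for x \<phi>
    proof (rule ccontr)
      assume "x \<notin> irregular_set \<phi> f"
      then obtain l where l: "(\<lambda>n. birkhoff_average f \<phi> n x) \<longlonglongrightarrow> l"
        unfolding irregular_set_def convergent_def by blast
      obtain y where y: "y \<in> irregular_set \<phi> f" and cont: "continuous_on UNIV \<phi>"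
        using \<phi> unfolding irregular_observables_def by blast
      have "(\<lambda>n. birkhoff_average f \<phi> n y) \<longlonglongrightarrow> l"
      proof (rule tendstoI)
        fix e :: real assume "e > 0"
        then have "e / 2 > 0" by simp
        note upper = eventually_le[OF x cont l this, of y]
        have "(\<lambda>n. birkhoff_average f (\<lambda>x. - \<phi> x) n x) \<longlonglongrightarrow> - l"
          unfolding birkhoff_average_uminus by (rule tendsto_minus) (rule l)
        note lower = eventually_le[OF x continuous_on_minus[OF cont] this \<open>e / 2 > 0\<close>, of y,
            unfolded birkhoff_average_uminus]
        show "\<forall>\<^sub>F n in sequentially. dist (birkhoff_average f \<phi> n y) l < e"
          using upper lower by eventually_elim (use \<open>e > 0\<close> in \<open>auto simp: dist_real_def abs_less_iff\<close>)
      qed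
      with y show False unfolding irregular_set_def convergent_def by blast
    qed
    then show ?thesis unfolding completely_irregular_set_def by blast
  qed
  ultimately show ?thesis
    unfolding residual_in_def using \<open>countable J\<close>
    by (intro conjI exI[of _ "G ` J"]) auto
qed

section \<open>Shadowing\<close>

text \<open>An index in \<open>\<Lambda>\<close> costs at most \<open>\<eta>\<close>, any other at
  most \<open>2 * B\<close>. The exceptions will be the initial gap under specification and the
  \<open>g n\<close> errors under the almost product property.\<close>

lemma sum_ge_of_almost_ge:
  fixes u v :: "nat \<Rightarrow> real"
  assumes "\<And>i. \<bar>u i\<bar> \<le> B" "\<And>i. \<bar>v i\<bar> \<le> B" and "\<eta> \<ge> 0"
    and close: "\<And>i. i \<in> \<Lambda> \<Longrightarrow> u i \<ge> v i - \<eta>"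
    and \<Lambda>: "\<Lambda> \<subseteq> {..<n}" "card ({..<n} - \<Lambda>) \<le> k"
  shows "(\<Sum>i<n. u i) \<ge> (\<Sum>i<n. v i) - real n * \<eta> - 2 * B * real k"
proof -
  have "B \<ge> 0" using assms(1)[of 0] by linarith
  have "(\<Sum>i<n. v i - u i) \<le> (\<Sum>i<n. \<eta> + (if i \<in> {..<n} - \<Lambda> then 2 * B else 0))"
  proof (rule sum_mono)
    fix i assume "i \<in> {..<n}"
    then show "v i - u i \<le> \<eta> + (if i \<in> {..<n} - \<Lambda> then 2 * B else 0)"
      using close[of i] assms(1)[of i] assms(2)[of i] \<open>\<eta> \<ge> 0\<close> by auto
  qed
  also have "\<dots> = real n * \<eta> + 2 * B * real (card ({..<n} - \<Lambda>))"
    by (subst sum.distrib, subst sum.If_cases) (auto intro!: arg_cong[where f=card])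
  also have "\<dots> \<le> real n * \<eta> + 2 * B * real k"
    using \<Lambda>(2) \<open>B \<ge> 0\<close> by (intro add_mono mult_left_mono) auto
  finally show ?thesis by (simp add: sum_subtractf)
qed

text \<open>Each step along the orbit drops the first term and appends a new one, at a cost of at
  most \<open>2 * B\<close>.\<close>

lemma orbit_sum_shift:
  fixes \<phi> :: "'a \<Rightarrow> real"
  assumes B: "\<And>x. \<bar>\<phi> x\<bar> \<le> B"
  shows "(\<Sum>i<n. \<phi> ((f ^^ i) w)) \<ge> (\<Sum>i<n. \<phi> ((f ^^ i) ((f ^^ s) w))) - 2 * B * real s"
proof (induction s)
  case (Suc s)
  let ?w = "(f ^^ s) w"
  have "(\<Sum>i<n. \<phi> ((f ^^ i) ((f ^^ Suc s) w))) - (\<Sum>i<n. \<phi> ((f ^^ i) ?w))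
      = (\<Sum>i<n. \<phi> ((f ^^ Suc i) ?w) - \<phi> ((f ^^ i) ?w))"
    by (simp add: sum_subtractf funpow_swap1)
  also have "\<dots> = \<phi> ((f ^^ n) ?w) - \<phi> ?w"
    by (subst sum_lessThan_telescope[of "\<lambda>i. \<phi> ((f ^^ i) ?w)"]) simp
  also have "\<dots> \<le> 2 * B" using B[of "(f ^^ n) ?w"] B[of ?w] by linarith
  finally show ?case using Suc by (simp add: distrib_left)
qed simp

section \<open>Density of large averages under specification\<close>

lemma bounded_observable:
  fixes \<phi> :: "'a::topological_space \<Rightarrow> real"
  assumes "compact (UNIV :: 'a set)" "continuous_on UNIV \<phi>"
  obtains B where "\<And>x. \<bar>\<phi> x\<bar> \<le> B"
proof -
  have "bounded (range \<phi>)"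
    using compact_continuous_image[OF assms(2,1)] by (rule compact_imp_bounded)
  then show ?thesis using that by (auto simp: bounded_iff)
qed

lemma observable_modulus:
  fixes \<phi> :: "'a::metric_space \<Rightarrow> real"
  assumes "compact (UNIV :: 'a set)" "continuous_on UNIV \<phi>" "\<eta> > 0"
  obtains \<delta> where "\<delta> > 0" "\<And>x y. dist x y < \<delta> \<Longrightarrow> \<bar>\<phi> x - \<phi> y\<bar> < \<eta>"
  using compact_uniformly_continuous[OF assms(2,1)] assms(3)
  unfolding uniformly_continuous_on_def dist_real_def by (metis UNIV_I dist_commute)

text \<open>Specification follows \<open>y\<close> at its own times, so the averages of
  \<open>x\<close> and \<open>y\<close> are compared without a shift; only the times before
  \<open>m\<close> are uncontrolled.\<close>

lemma specification_approx:
  fixes f :: "'a::metric_space \<Rightarrow> 'a"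
  assumes compact: "compact (UNIV :: 'a set)" and spec: "specification_property f"
    and \<phi>: "continuous_on UNIV \<phi>"
    and freq: "\<exists>\<^sub>F n in sequentially. birkhoff_average f \<phi> n y > \<beta>" and "\<alpha> < \<beta>" "\<delta> > 0"
  shows "\<exists>x. dist x x0 < \<delta> \<and> (\<exists>n\<ge>N. birkhoff_average f \<phi> n x > \<alpha>)"
proof -
  obtain B where B: "\<And>x. \<bar>\<phi> x\<bar> \<le> B" using bounded_observable[OF compact \<phi>] by blast
  \<comment> \<open>One half of the margin pays for the shadowing error, the other for the
    gap.\<close>
  define \<eta> where "\<eta> = (\<beta> - \<alpha>) / 2"
  have "\<eta> > 0" using \<open>\<alpha> < \<beta>\<close> by (simp add: \<eta>_def)
  obtain \<delta>' where "\<delta>' > 0" and \<delta>': "\<And>x y. dist x y < \<delta>' \<Longrightarrow> \<bar>\<phi> x - \<phi> y\<bar> < \<eta>"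
    using observable_modulus[OF compact \<phi> \<open>\<eta> > 0\<close>] by blast
  define \<epsilon> where "\<epsilon> = min \<delta> \<delta>'"
  have "\<epsilon> > 0" using \<open>\<delta> > 0\<close> \<open>\<delta>' > 0\<close> by (simp add: \<epsilon>_def)
  then obtain M :: nat where M: "\<forall>k\<ge>2. \<forall>(x :: nat \<Rightarrow> 'a) (a :: nat \<Rightarrow> nat) (b :: nat \<Rightarrow> nat).
        (\<forall>i\<in>{1..k}. a i \<le> b i) \<and>
        (\<forall>i\<in>{1..<k}. b i < a (Suc i) \<and> b i + M \<le> a (Suc i)) \<longrightarrow>
        (\<exists>y. \<forall>i\<in>{1..k}. \<forall>j\<in>{a i..b i}. dist ((f ^^ j) y) ((f ^^ j) (x i)) < \<epsilon>)"
    using spec unfolding specification_property_def by metis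
  \<comment> \<open>The second segment must start strictly after time 0, even if \<open>M\<close> is
    0.\<close>
  define m where "m = max 1 M"
  have "(\<lambda>n. 2 * B * real m / real n) \<longlonglongrightarrow> 0" by (rule lim_const_over_n)
  then have "\<forall>\<^sub>F n in sequentially. 2 * B * real m / real n < \<eta>"
    using \<open>\<eta> > 0\<close> by (rule order_tendstoD)
  moreover have "\<forall>\<^sub>F n in sequentially. n \<ge> max N (Suc m)" by (rule eventually_ge_at_top)
  ultimately have "\<forall>\<^sub>F n in sequentially. 2 * B * real m / real n < \<eta> \<and> n \<ge> max N (Suc m)"
    by eventually_elim simp
  from frequently_ex[OF frequently_eventually_frequently[OF freq this]]
  obtain n where n: "birkhoff_average f \<phi> n y > \<beta>" "2 * B * real m / real n < \<eta>" "n \<ge> N" "n > m"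
    by auto
  have "\<exists>x. \<forall>i\<in>{1..2}. \<forall>j\<in>{(if i = 1 then 0 else m)..(if i = 1 then 0 else n)}.
      dist ((f ^^ j) x) ((f ^^ j) (if i = (1::nat) then x0 else y)) < \<epsilon>"
    using n by (intro M[rule_format]) (auto simp: m_def)
  then obtain x where x: "\<forall>i\<in>{1..2}. \<forall>j\<in>{(if i = 1 then 0 else m)..(if i = 1 then 0 else n)}.
      dist ((f ^^ j) x) ((f ^^ j) (if i = (1::nat) then x0 else y)) < \<epsilon>"
    by blast
  have x0: "dist x x0 < \<epsilon>" using x[rule_format, of 1 0] by simp
  have y: "dist ((f ^^ j) x) ((f ^^ j) y) < \<epsilon>" if "j \<in> {m..n}" for j
    using x[rule_format, of 2 j] that by simp
  have "card ({..<n} - {m..<n}) \<le> card {..<m}" by (intro card_mono) auto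
  then have card: "card ({..<n} - {m..<n}) \<le> m" by simp
  have "(\<Sum>i<n. \<phi> ((f ^^ i) x)) \<ge> (\<Sum>i<n. \<phi> ((f ^^ i) y)) - real n * \<eta> - 2 * B * real m"
  proof (rule sum_ge_of_almost_ge[OF B B])
    fix i assume "i \<in> {m..<n}"
    then have "\<bar>\<phi> ((f ^^ i) x) - \<phi> ((f ^^ i) y)\<bar> < \<eta>"
      using y[of i] by (intro \<delta>') (simp add: \<epsilon>_def)
    then show "\<phi> ((f ^^ i) x) \<ge> \<phi> ((f ^^ i) y) - \<eta>" by linarith
  qed (use \<open>\<eta> > 0\<close> card in auto)
  then have "(\<Sum>i<n. \<phi> ((f ^^ i) x)) / real n
      \<ge> ((\<Sum>i<n. \<phi> ((f ^^ i) y)) - real n * \<eta> - 2 * B * real m) / real n"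
    by (intro divide_right_mono) auto
  then have "birkhoff_average f \<phi> n x \<ge> birkhoff_average f \<phi> n y - \<eta> - 2 * B * real m / real n"
    using \<open>n > m\<close> by (simp add: diff_divide_distrib)
  with n have "birkhoff_average f \<phi> n x > \<alpha>" unfolding \<eta>_def by argo
  with x0 n(3) show ?thesis unfolding \<epsilon>_def by auto
qed

section \<open>Density of large averages in the union of supports under almost specification\<close>

lemma exists_many_visits:
  fixes f :: "'a::metric_space \<Rightarrow> 'a"
  assumes f: "continuous_on UNIV f" and \<nu>: "\<nu> \<in> invariant_measures f" and "open U"
    and h: "real h < real n * measure \<nu> U"
  obtains z where "h < card {i. i < n \<and> (f ^^ i) z \<in> U}"
proof -
  interpret prob_space \<nu> using \<nu> by (simp add: invariant_measures_def)
  have sets: "sets \<nu> = sets borel" and inv: "distr \<nu> borel f = \<nu>"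
    using \<nu> by (auto simp: invariant_measures_def)
  have space: "space \<nu> = UNIV" using sets_eq_imp_space_eq[OF sets] by simp
  have open_vimage': "open ((f ^^ i) -` U)" for i
    by (rule open_vimage[OF \<open>open U\<close> continuous_on_funpow[OF f]])
  have "f \<in> measurable \<nu> borel"
    using borel_measurable_continuous_onI[OF f] by (simp cong: measurable_cong_sets add: sets)
  then have step: "prob (f -` V) = prob V" if "open V" for V
    using that measure_distr[of f \<nu> borel V] by (simp add: inv space)
  have prob_eq: "prob ((f ^^ i) -` U) = prob U" for i
  proof (induction i)
    case (Suc i)
    have eq: "(f ^^ Suc i) -` U = f -` ((f ^^ i) -` U)" by (auto simp: funpow_swap1)
    then show ?case using step[OF open_vimage'[of i]] Suc by (simp only: eq)
  qed simp
  \<comment> \<open>By invariance the expected number of visits is \<open>n * prob U\<close>, so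
    some point must exceed every \<open>h\<close> below this value.\<close>
  let ?count = "\<lambda>z. card {i. i < n \<and> (f ^^ i) z \<in> U}"
  have count: "real (?count z) = (\<Sum>i<n. indicator ((f ^^ i) -` U) z)" for z
  proof -
    have "(\<Sum>i<n. indicator ((f ^^ i) -` U) z) = (\<Sum>i<n. if (f ^^ i) z \<in> U then 1 else 0 :: real)"
      by (intro sum.cong) (auto simp: indicator_def)
    also have "\<dots> = real (?count z)"
      by (subst sum.If_cases) (auto intro: arg_cong[where f=card])
    finally show ?thesis ..
  qed
  have int: "integrable \<nu> (indicator ((f ^^ i) -` U) :: 'a \<Rightarrow> real)" for i
    using open_vimage'[of i] by (simp add: integrable_indicator_iff sets less_top[symmetric])
  have "expectation (\<lambda>z. real (?count z)) = (\<Sum>i<n. prob ((f ^^ i) -` U))"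
    unfolding count using int by (simp add: Bochner_Integration.integral_sum space)
  then have expect: "expectation (\<lambda>z. real (?count z)) = real n * prob U"
    by (simp add: prob_eq)
  have int_count: "integrable \<nu> (\<lambda>z. real (?count z))"
    unfolding count using int by simp
  have "\<exists>z. h < ?count z"
  proof (rule ccontr)
    assume "\<not> ?thesis"
    then have "expectation (\<lambda>z. real (?count z)) \<le> expectation (\<lambda>_. real h)"
      using int_count by (intro integral_mono) (auto simp: not_less)
    then show False using h expect by (simp add: prob_space)
  qed
  then show ?thesis using that by blast
qed

lemma sum_ge_of_block_visits:
  fixes u :: "nat \<Rightarrow> real"
  assumes "\<And>t. u t \<ge> 0" and "\<And>i. i < K \<Longrightarrow> \<exists>t\<in>{i * P..<i * P + P}. u t \<ge> 1"
  shows "(\<Sum>t<K * P. u t) \<ge> real K"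
proof -
  have "1 \<le> (\<Sum>t\<in>{i * P..<i * P + P}. u t)" if i: "i < K" for i
  proof -
    obtain t where t: "t \<in> {i * P..<i * P + P}" "u t \<ge> 1" using assms(2)[OF i] by blast
    have "u t \<le> (\<Sum>t\<in>{i * P..<i * P + P}. u t)"
      using t(1) assms(1) by (intro member_le_sum) auto
    with t(2) show ?thesis by linarith
  qed
  then have "(\<Sum>i<K. 1) \<le> (\<Sum>i<K. \<Sum>t\<in>{i * P..<i * P + P}. u t)"
    by (intro sum_mono) auto
  then show ?thesis by (simp add: sum.nat_group)
qed

lemma almost_product_alternating:
  fixes f :: "'a::metric_space \<Rightarrow> 'a"
  assumes app: "\<forall>k\<ge>2. \<forall>(x :: nat \<Rightarrow> 'a) (\<epsilon> :: nat \<Rightarrow> real) (n :: nat \<Rightarrow> nat).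
      (\<forall>i\<in>{1..k}. \<epsilon> i > 0 \<and> n i \<ge> m (\<epsilon> i)) \<longrightarrow>
      (\<Inter>j\<in>{1..k}. (f ^^ (\<Sum>i\<in>{1..<j}. n i)) -` almost_ball f (n j) g (x j) (\<epsilon> j)) \<noteq> {}"
    and "\<epsilon> > 0" "n \<ge> m \<epsilon>" "L \<ge> m \<epsilon>"
  obtains x where
    "\<And>i. i \<le> K \<Longrightarrow> (f ^^ (i * (n + L))) x \<in> almost_ball f n g z \<epsilon>"
    "\<And>i. i \<le> K \<Longrightarrow> (f ^^ (i * (n + L) + n)) x \<in> almost_ball f L g y \<epsilon>"
proof -
  let ?n = "\<lambda>i :: nat. if odd i then n else L"
  let ?x = "\<lambda>i :: nat. if odd i then z else y"
  \<comment> \<open>Blocks are numbered from 1, so block \<open>2 * i + 1\<close> opens period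
    \<open>i\<close> and follows \<open>z\<close>; block \<open>2 * i + 2\<close> starts
    \<open>n\<close> steps later and follows \<open>y\<close>.\<close>
  have odd_sum: "(\<Sum>i\<in>{1..<Suc (2 * i)}. ?n i) = i * (n + L)" for i
    by (induction i) (auto simp: sum.atLeastLessThan_Suc)
  have even_sum: "(\<Sum>i\<in>{1..<Suc (Suc (2 * i))}. ?n i) = i * (n + L) + n" for i
    using odd_sum[of i] by (simp add: sum.atLeastLessThan_Suc)
  have "(\<Inter>j\<in>{1..2 * Suc K}. (f ^^ (\<Sum>i\<in>{1..<j}. ?n i)) -`
      almost_ball f (?n j) g (?x j) \<epsilon>) \<noteq> {}"
    using assms(2-4) by (intro app[rule_format]) auto
  then obtain x where x: "\<And>j. j \<in> {1..2 * Suc K} \<Longrightarrow>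
      (f ^^ (\<Sum>i\<in>{1..<j}. ?n i)) x \<in> almost_ball f (?n j) g (?x j) \<epsilon>"
    by blast
  show ?thesis
  proof (rule that)
    fix i assume i: "i \<le> K"
    show "(f ^^ (i * (n + L))) x \<in> almost_ball f n g z \<epsilon>"
      using x[of "Suc (2 * i)"] i unfolding odd_sum by simp
    show "(f ^^ (i * (n + L) + n)) x \<in> almost_ball f L g y \<epsilon>"
      using x[of "Suc (Suc (2 * i))"] i unfolding even_sum by simp
  qed
qed

text \<open>An orbit segment of \<open>z\<close> visiting the ball about \<open>x0\<close> more than \<open>g n\<close> times is alternated
  with a much longer one of \<open>y\<close>. A point shadowing this pattern visits, once per period, the
  closed set \<open>C\<close> of those points near \<open>x0\<close> whose average is large, so some invariant measure
  charges \<open>C\<close>.\<close>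

lemma almost_specification_approx:
  fixes f :: "'a::metric_space \<Rightarrow> 'a"
  assumes compact: "compact (UNIV :: 'a set)" and f: "continuous_on UNIV f"
    and spec: "almost_specification f" and \<phi>: "continuous_on UNIV \<phi>"
    and freq: "\<exists>\<^sub>F n in sequentially. birkhoff_average f \<phi> n y > \<beta>" and "\<alpha> < \<beta>"
    and x0: "x0 \<in> supports_union f" and "\<delta> > 0"
  shows "\<exists>x\<in>supports_union f. dist x x0 < \<delta> \<and> (\<exists>n\<ge>N. birkhoff_average f \<phi> n x > \<alpha>)"
proof -
  obtain g where g: "(\<lambda>n. real (g n) / real n) \<longlonglongrightarrow> 0" and "almost_product_property g f"
    using spec unfolding almost_specification_def blowup_function_def by (elim exE conjE) (rule that)
  then obtain m where app: "\<forall>k\<ge>2. \<forall>(x :: nat \<Rightarrow> 'a) (\<epsilon> :: nat \<Rightarrow> real) (n :: nat \<Rightarrow> nat).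
      (\<forall>i\<in>{1..k}. \<epsilon> i > 0 \<and> n i \<ge> m (\<epsilon> i)) \<longrightarrow>
      (\<Inter>j\<in>{1..k}. (f ^^ (\<Sum>i\<in>{1..<j}. n i)) -` almost_ball f (n j) g (x j) (\<epsilon> j)) \<noteq> {}"
    unfolding almost_product_property_def by (elim exE conjE) (rule that)
  obtain B where B: "\<And>x. \<bar>\<phi> x\<bar> \<le> B" using bounded_observable[OF compact \<phi>] by blast
  \<comment> \<open>Two losses of \<open>\<eta>\<close>, from shadowing and from errors plus delay,
    lead from \<open>\<beta>\<close> down to the midpoint
    \<open>(\<alpha> + \<beta>) / 2\<close>.\<close>
  define \<eta> where "\<eta> = (\<beta> - \<alpha>) / 4"
  have "\<eta> > 0" using \<open>\<alpha> < \<beta>\<close> by (simp add: \<eta>_def)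
  obtain \<delta>' where "\<delta>' > 0" and \<delta>': "\<And>x y. dist x y < \<delta>' \<Longrightarrow> \<bar>\<phi> x - \<phi> y\<bar> < \<eta>"
    using observable_modulus[OF compact \<phi> \<open>\<eta> > 0\<close>] by blast
  \<comment> \<open>A ball of radius \<open>\<delta> / 4\<close> enlarged by
    \<open>\<epsilon>\<close> stays within \<open>\<delta> / 2\<close>. Halving
    \<open>\<delta>'\<close> gives a strict bound, since almost balls only provide
    \<open>\<le>\<close>.\<close>
  define \<epsilon> where "\<epsilon> = min (\<delta> / 4) (\<delta>' / 2)"
  have \<epsilon>: "\<epsilon> > 0" "\<epsilon> \<le> \<delta> / 4" "\<epsilon> < \<delta>'"
    using \<open>\<delta> > 0\<close> \<open>\<delta>' > 0\<close> by (auto simp: \<epsilon>_def)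

  obtain \<nu> where \<nu>: "\<nu> \<in> invariant_measures f" "x0 \<in> measure_support \<nu>"
    using x0 unfolding supports_union_def by blast
  interpret \<nu>: prob_space \<nu> using \<nu>(1) by (simp add: invariant_measures_def)
  let ?U = "ball x0 (\<delta> / 4)"
  have "emeasure \<nu> ?U > 0"
    using \<nu>(2) \<open>\<delta> > 0\<close> unfolding measure_support_def by auto
  then have "measure \<nu> ?U > 0" by (simp add: \<nu>.emeasure_eq_measure)
  with g have "\<forall>\<^sub>F n in sequentially. real (g n) / real n < measure \<nu> ?U"
    by (rule order_tendstoD)
  moreover have "\<forall>\<^sub>F n in sequentially. n \<ge> max 1 (m \<epsilon>)" by (rule eventually_ge_at_top)
  ultimately have "\<forall>\<^sub>F n in sequentially. real (g n) / real n < measure \<nu> ?U \<and> n \<ge> max 1 (m \<epsilon>)"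
    by eventually_elim simp
  from eventually_happens'[OF sequentially_bot this]
  obtain n where "real (g n) / real n < measure \<nu> ?U" and n: "n \<ge> 1" "n \<ge> m \<epsilon>"
    by auto
  then have "real (g n) < real n * measure \<nu> ?U" by (simp add: divide_less_eq mult.commute)
  then obtain z where z: "g n < card {i. i < n \<and> (f ^^ i) z \<in> ?U}"
    using exists_many_visits[OF f \<nu>(1) open_ball] by blast

  \<comment> \<open>With \<open>n\<close> fixed first, both the \<open>g L\<close> errors and a
    delay of at most \<open>n\<close> steps are negligible against \<open>L\<close>.\<close>
  have "(\<lambda>L. 2 * B * (real (g L) / real L) + 2 * B * real n / real L) \<longlonglongrightarrow> 2 * B * 0 + 0"
    by (intro tendsto_intros g)
  then have "\<forall>\<^sub>F L in sequentially. 2 * B * (real (g L) / real L) + 2 * B * real n / real L < \<eta>"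
    using \<open>\<eta> > 0\<close> by (intro order_tendstoD) auto
  moreover have "\<forall>\<^sub>F L in sequentially. L \<ge> max N (max 1 (m \<epsilon>))" by (rule eventually_ge_at_top)
  ultimately have "\<forall>\<^sub>F L in sequentially.
      2 * B * (real (g L) / real L) + 2 * B * real n / real L < \<eta> \<and> L \<ge> max N (max 1 (m \<epsilon>))"
    by eventually_elim simp
  from frequently_ex[OF frequently_eventually_frequently[OF freq this]]
  obtain L where L: "birkhoff_average f \<phi> L y > \<beta>" "L \<ge> N" "L \<ge> 1" "L \<ge> m \<epsilon>"
      "2 * B * (real (g L) / real L) + 2 * B * real n / real L < \<eta>"
    by auto

  define P where "P = n + L"
  have "P \<ge> 1" using n by (simp add: P_def)
  \<comment> \<open>The non-strict conditions make \<open>C\<close> closed, so that visit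
    frequencies pass to the limit measure; the midpoint still lies above
    \<open>\<alpha>\<close>.\<close>
  define C where "C = cball x0 (\<delta> / 2) \<inter> {w. birkhoff_average f \<phi> L w \<ge> (\<alpha> + \<beta>) / 2}"
  have "closed C"
    unfolding C_def by (intro closed_Int closed_cball closed_Collect_le continuous_on_const
        continuous_on_birkhoff_average f \<phi>)
  have "\<exists>x. \<forall>i\<le>K. (f ^^ (i * P)) x \<in> almost_ball f n g z \<epsilon> \<and>
      (f ^^ (i * P + n)) x \<in> almost_ball f L g y \<epsilon>" for K
    using almost_product_alternating[OF app \<epsilon>(1) n(2) L(4), of K z y] unfolding P_def by metis
  then obtain x where x: "\<And>K i. i \<le> K \<Longrightarrow> (f ^^ (i * P)) (x K) \<in> almost_ball f n g z \<epsilon>"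
      "\<And>K i. i \<le> K \<Longrightarrow> (f ^^ (i * P + n)) (x K) \<in> almost_ball f L g y \<epsilon>"
    by metis

  have visit: "\<exists>t\<in>{i * P..<i * P + P}. (f ^^ t) (x K) \<in> C" if i: "i \<le> K" for i K
  proof -
    define v where "v = (f ^^ (i * P)) (x K)"
    obtain \<Lambda> where \<Lambda>: "\<Lambda> \<subseteq> {..<n}" "card ({..<n} - \<Lambda>) \<le> g n"
        "\<forall>j\<in>\<Lambda>. dist ((f ^^ j) z) ((f ^^ j) v) \<le> \<epsilon>"
      using x(1)[OF i] unfolding v_def almost_ball_def by blast
    \<comment> \<open>Pigeonhole: \<open>z\<close> visits the ball more than \<open>g n\<close>
      times, so some visit falls at a time without shadowing error.\<close>
    have "\<not> {i. i < n \<and> (f ^^ i) z \<in> ?U} \<subseteq> {..<n} - \<Lambda>"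
    proof
      assume "{i. i < n \<and> (f ^^ i) z \<in> ?U} \<subseteq> {..<n} - \<Lambda>"
      from card_mono[OF _ this] z \<Lambda>(2) show False by simp
    qed
    then obtain j where j: "j < n" "(f ^^ j) z \<in> ?U" "j \<in> \<Lambda>" by auto
    define w where "w = (f ^^ j) v"
    have "dist ((f ^^ j) z) w \<le> \<epsilon>" using \<Lambda>(3) j(3) by (simp add: w_def)
    then have near: "dist x0 w \<le> \<delta> / 2"
      using j(2) \<epsilon>(2) dist_triangle[of x0 w "(f ^^ j) z"] by simp
    \<comment> \<open>From \<open>w\<close> the segment shadowing \<open>y\<close> begins after at
      most \<open>n\<close> steps, the delay allowed for in the choice of \<open>L\<close>.\<close>
    have shift: "(f ^^ (n - j)) w = (f ^^ n) v"
      using j(1) by (simp add: w_def funpow_add[symmetric, unfolded comp_def fun_eq_iff, rule_format])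
    have "(f ^^ n) v = (f ^^ (i * P + n)) (x K)"
      by (subst add.commute) (simp add: v_def funpow_add)
    then obtain \<Lambda>' where \<Lambda>': "\<Lambda>' \<subseteq> {..<L}" "card ({..<L} - \<Lambda>') \<le> g L"
        "\<forall>j\<in>\<Lambda>'. dist ((f ^^ j) y) ((f ^^ j) ((f ^^ n) v)) \<le> \<epsilon>"
      using x(2)[OF i] unfolding almost_ball_def by auto
    have "(\<Sum>i<L. \<phi> ((f ^^ i) ((f ^^ n) v)))
        \<ge> (\<Sum>i<L. \<phi> ((f ^^ i) y)) - real L * \<eta> - 2 * B * real (g L)"
    proof (rule sum_ge_of_almost_ge[OF B B _ _ \<Lambda>'(1,2)])
      fix i assume "i \<in> \<Lambda>'"
      then have "\<bar>\<phi> ((f ^^ i) y) - \<phi> ((f ^^ i) ((f ^^ n) v))\<bar> < \<eta>"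
        using \<Lambda>'(3) \<epsilon>(3) by (intro \<delta>') fastforce
      then show "\<phi> ((f ^^ i) ((f ^^ n) v)) \<ge> \<phi> ((f ^^ i) y) - \<eta>" by linarith
    qed (use \<open>\<eta> > 0\<close> in simp)
    moreover have "(\<Sum>i<L. \<phi> ((f ^^ i) w))
        \<ge> (\<Sum>i<L. \<phi> ((f ^^ i) ((f ^^ n) v))) - 2 * B * real (n - j)"
      using orbit_sum_shift[OF B, where n = L and f = f and s = "n - j" and w = w] by (simp only: shift)
    moreover have "2 * B * real (n - j) \<le> 2 * B * real n"
      using B[of x0] by (intro mult_left_mono) auto
    ultimately have "(\<Sum>i<L. \<phi> ((f ^^ i) w))
        \<ge> (\<Sum>i<L. \<phi> ((f ^^ i) y)) - real L * \<eta> - 2 * B * real (g L) - 2 * B * real n"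
      by linarith
    then have "(\<Sum>i<L. \<phi> ((f ^^ i) w)) / real L
        \<ge> ((\<Sum>i<L. \<phi> ((f ^^ i) y)) - real L * \<eta> - 2 * B * real (g L) - 2 * B * real n) / real L"
      by (intro divide_right_mono) auto
    then have "birkhoff_average f \<phi> L w \<ge> birkhoff_average f \<phi> L y - \<eta>
        - (2 * B * (real (g L) / real L) + 2 * B * real n / real L)"
      using \<open>L \<ge> 1\<close> by (simp add: diff_divide_distrib)
    with L(1,5) have "birkhoff_average f \<phi> L w \<ge> (\<alpha> + \<beta>) / 2"
      unfolding \<eta>_def by argo
    with near have "w \<in> C" by (simp add: C_def)
    moreover have "w = (f ^^ (i * P + j)) (x K)"
      by (subst add.commute) (simp add: w_def v_def funpow_add)
    moreover have "i * P + j \<in> {i * P..<i * P + P}" using j(1) by (simp add: P_def)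
    ultimately show ?thesis by metis
  qed

  \<comment> \<open>The periods \<open>0\<close> to \<open>K\<close> contain one visit each, so the
    frequency is at least \<open>1 / real P\<close>, with \<open>P\<close> fixed while
    \<open>K\<close> grows.\<close>
  have T: "filterlim (\<lambda>K. Suc K * P) at_top sequentially"
  proof (rule filterlim_at_top_mono[OF filterlim_ident always_eventually], rule allI)
    show "K \<le> Suc K * P" for K
      using mult_le_mono[of K "Suc K" 1 P] \<open>P \<ge> 1\<close> by simp
  qed
  have "1 / real P * real (Suc K * P) \<le> (\<Sum>t<Suc K * P. indicator C ((f ^^ t) (x K)))" for K
  proof -
    have "real (Suc K) \<le> (\<Sum>t<Suc K * P. indicator C ((f ^^ t) (x K)))"
      using visit[of _ K] by (intro sum_ge_of_block_visits) (force simp: less_Suc_eq_le)+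
    moreover have "1 / real P * real (Suc K * P) = real (Suc K)"
      using \<open>P \<ge> 1\<close> by (simp del: mult_Suc of_nat_Suc)
    ultimately show ?thesis by (simp only:)
  qed
  then obtain \<mu> where \<mu>: "\<mu> \<in> invariant_measures f" "ennreal (1 / real P) \<le> emeasure \<mu> C"
    using invariant_measure_of_visits[OF compact f T \<open>closed C\<close>] by blast
  then have "emeasure \<mu> C > 0"
    using \<open>P \<ge> 1\<close> by (intro less_le_trans[OF _ \<mu>(2)]) simp
  moreover have "sets \<mu> = sets borel" using \<mu>(1) by (simp add: invariant_measures_def)
  ultimately obtain w where w: "w \<in> C" "w \<in> measure_support \<mu>"
    using closed_meets_measure_support[OF compact \<open>closed C\<close>] by blast
  have "w \<in> supports_union f" using w(2) \<mu>(1) unfolding supports_union_def by blast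
  moreover have "dist w x0 < \<delta>" using w(1) \<open>\<delta> > 0\<close> by (simp add: C_def dist_commute)
  moreover have "birkhoff_average f \<phi> L w > \<alpha>"
  proof -
    have "(\<alpha> + \<beta>) / 2 \<le> birkhoff_average f \<phi> L w" using w(1) unfolding C_def by blast
    with \<open>\<alpha> < \<beta>\<close> show ?thesis by argo
  qed
  ultimately show ?thesis using L(2) by blast
qed

theorem theorem2p17:
  fixes f :: "'a::metric_space \<Rightarrow> 'a"
  assumes "compact (UNIV :: 'a set)"
    and "continuous_on UNIV f"
    and "\<not> uniquely_ergodic f"
  shows "(specification_property f \<longrightarrow> residual_in euclidean (completely_irregular_set f)) \<and>
         (almost_specification f \<longrightarrow>
            residual_in (top_of_set (supports_union f))
              (completely_irregular_set f \<inter> supports_union f))"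
proof (intro conjI impI)
  assume spec: "specification_property f"
  \<comment> \<open>For \<open>S = UNIV\<close> membership in \<open>S\<close> is automatic, so the
    approximating point may be the shadowing point itself.\<close>
  have "residual_in (top_of_set UNIV) (completely_irregular_set f \<inter> UNIV)"
    by (rule residual_completely_irregular[OF assms(1,2)])
      (unfold bex_UNIV, rule specification_approx[OF assms(1) spec])
  then show "residual_in euclidean (completely_irregular_set f)" by simp
next
  assume spec: "almost_specification f"
  show "residual_in (top_of_set (supports_union f)) (completely_irregular_set f \<inter> supports_union f)"
    by (rule residual_completely_irregular[OF assms(1,2)])
      (rule almost_specification_approx[OF assms(1,2) spec])
qed

end
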